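(* (1) The reduction $\to^{\mathsf w}_{\sigma\beta_c}$ is uniformly normalizing. (2) The reduction $\to^{\mathsf s}_{\sigma\beta_c}$ is uniformly normalizing. Moreover, all maximal $\to^{\mathsf w}_{\sigma\beta_c}$-sequences (resp. all maximal $\to^{\mathsf s}_{\sigma\beta_c}$-sequences) from the same computation $M$ have the same number of $\beta_c$ steps.
   Context: The computational core $\lambda_{\copyright}$ has values $V,W ::= x \mid \lambda x.M$ and computations $M,N,L ::= \,!V \mid VM$ ($x$ ranging over a countable set of variables, terms up to $\alpha$-renaming). Rules: $\beta_c$: $(\lambda x.M)(!V) \mapsto M\{V/x\}$; $\sigma$: $(\lambda y.N)((\lambda x.M)L) \mapsto (\lambda x.(\lambda y.N)M)L$ provided $x\notin \mathrm{fv}(N)$; $\sigma\beta_c=\sigma\cup\beta_c$. Surface contexts $S ::= [\,]\mid VS\mid(\lambda x.S)M$; weak contexts $W ::= [\,]\mid VW$; $\to^{\mathsf s}_\rho$ / $\to^{\mathsf w}_\rho$ is closure of rule $\rho$ under surface / weak contexts. A maximal sequence is either infinite or ends in a normal form. A reduction $\to$ is uniformly normalizing if every term that is weakly $\to$-normalizing (has some $\to$-sequence ending in a $\to$-normal form) is strongly $\to$-normalizing (has no infinite $\to$-sequence). *)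

theory Defs
  imports Main "HOL-Library.Extended_Nat"
begin

text \<open>Terms up to alpha-renaming are represented with de Bruijn indices. A free variable is an
  index pointing beyond all enclosing abstractions.\<close>

datatype val = Var nat | Lam comp
  and comp = Bang val | App val comp

primrec lift_val :: "val \<Rightarrow> nat \<Rightarrow> val"
  and lift_comp :: "comp \<Rightarrow> nat \<Rightarrow> comp"
where
  "lift_val (Var i) k = (if i < k then Var i else Var (Suc i))"
| "lift_val (Lam M) k = Lam (lift_comp M (Suc k))"
| "lift_comp (Bang V) k = Bang (lift_val V k)"
| "lift_comp (App V M) k = App (lift_val V k) (lift_comp M k)"

text \<open>Substituting \<open>U\<close> for index \<open>k\<close> also removes the binder of \<open>k\<close>: larger indices decrease.\<close>

primrec subst_val :: "val \<Rightarrow> val \<Rightarrow> nat \<Rightarrow> val"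
  and subst_comp :: "comp \<Rightarrow> val \<Rightarrow> nat \<Rightarrow> comp"
where
  "subst_val (Var i) U k = (if k < i then Var (i - 1) else if i = k then U else Var i)"
| "subst_val (Lam M) U k = Lam (subst_comp M (lift_val U 0) (Suc k))"
| "subst_comp (Bang V) U k = Bang (subst_val V U k)"
| "subst_comp (App V M) U k = App (subst_val V U k) (subst_comp M U k)"

inductive beta_c :: "comp \<Rightarrow> comp \<Rightarrow> bool" where
  "beta_c (App (Lam M) (Bang V)) (subst_comp M V 0)"

text \<open>In the contractum of \<open>sigma\<close> the computation \<open>N\<close> moves under the binder of \<open>x\<close>. Lifting \<open>N\<close>
  at cutoff 1 keeps its own bound variable \<open>y\<close> (index 0) in place and makes index 1, which
  is \<open>x\<close>, fresh; this is the proviso that \<open>x\<close> does not occur free in \<open>N\<close>.\<close>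

inductive sigma :: "comp \<Rightarrow> comp \<Rightarrow> bool" where
  "sigma (App (Lam N) (App (Lam M) L)) (App (Lam (App (Lam (lift_comp N 1)) M)) L)"

definition sigma_beta_c :: "comp \<Rightarrow> comp \<Rightarrow> bool" where
  "sigma_beta_c M N \<longleftrightarrow> sigma M N \<or> beta_c M N"

datatype surface_ctxt = SHole | SApp val surface_ctxt | SLam surface_ctxt comp

text \<open>Filling a hole may capture variables, so nothing is lifted.\<close>

primrec surface_fill :: "surface_ctxt \<Rightarrow> comp \<Rightarrow> comp" where
  "surface_fill SHole P = P"
| "surface_fill (SApp V S) P = App V (surface_fill S P)"
| "surface_fill (SLam S M) P = App (Lam (surface_fill S P)) M"

datatype weak_ctxt = WHole | WApp val weak_ctxt

primrec weak_fill :: "weak_ctxt \<Rightarrow> comp \<Rightarrow> comp" where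
  "weak_fill WHole P = P"
| "weak_fill (WApp V W) P = App V (weak_fill W P)"

definition surface :: "(comp \<Rightarrow> comp \<Rightarrow> bool) \<Rightarrow> comp \<Rightarrow> comp \<Rightarrow> bool" where
  "surface R M N \<longleftrightarrow> (\<exists>S P Q. R P Q \<and> M = surface_fill S P \<and> N = surface_fill S Q)"

definition weak :: "(comp \<Rightarrow> comp \<Rightarrow> bool) \<Rightarrow> comp \<Rightarrow> comp \<Rightarrow> bool" where
  "weak R M N \<longleftrightarrow> (\<exists>W P Q. R P Q \<and> M = weak_fill W P \<and> N = weak_fill W Q)"

definition normal_form :: "('a \<Rightarrow> 'a \<Rightarrow> bool) \<Rightarrow> 'a \<Rightarrow> bool" where
  "normal_form R a \<longleftrightarrow> \<not> (\<exists>b. R a b)"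

definition weakly_normalizing :: "('a \<Rightarrow> 'a \<Rightarrow> bool) \<Rightarrow> 'a \<Rightarrow> bool" where
  "weakly_normalizing R a \<longleftrightarrow> (\<exists>b. R\<^sup>*\<^sup>* a b \<and> normal_form R b)"

definition strongly_normalizing :: "('a \<Rightarrow> 'a \<Rightarrow> bool) \<Rightarrow> 'a \<Rightarrow> bool" where
  "strongly_normalizing R a \<longleftrightarrow> \<not> (\<exists>f :: nat \<Rightarrow> 'a. f 0 = a \<and> (\<forall>i. R (f i) (f (Suc i))))"

definition uniformly_normalizing :: "('a \<Rightarrow> 'a \<Rightarrow> bool) \<Rightarrow> bool" where
  "uniformly_normalizing R \<longleftrightarrow> (\<forall>a. weakly_normalizing R a \<longrightarrow> strongly_normalizing R a)"

text \<open>To count steps of one rule, a reduction sequence records at each step which rule is fired.\<close>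

datatype rule_name = Beta_c | Sigma

primrec rule_of :: "rule_name \<Rightarrow> comp \<Rightarrow> comp \<Rightarrow> bool" where
  "rule_of Beta_c = beta_c"
| "rule_of Sigma = sigma"

text \<open>\<open>maximal_seq cl M n t r\<close>, where \<open>cl\<close> is \<open>weak\<close> or \<open>surface\<close>: the sequence
  \<open>t 0, t 1, \<dots>\<close> starts from \<open>M\<close> and has \<open>n\<close> steps (infinitely many if \<open>n = \<infinity>\<close>), the step from
  \<open>t i\<close> to \<open>t (Suc i)\<close> fires rule \<open>r i\<close>, and if \<open>n\<close> is finite the last term \<open>t n\<close> is normal.
  The values \<open>t i\<close> for \<open>i > n\<close> and \<open>r i\<close> for \<open>i \<ge> n\<close> are irrelevant.\<close>

definition maximal_seq ::
  "((comp \<Rightarrow> comp \<Rightarrow> bool) \<Rightarrow> comp \<Rightarrow> comp \<Rightarrow> bool) \<Rightarrow> comp \<Rightarrow> enat \<Rightarrow> (nat \<Rightarrow> comp) \<Rightarrow>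
    (nat \<Rightarrow> rule_name) \<Rightarrow> bool"
where
  "maximal_seq cl M n t r \<longleftrightarrow>
     t 0 = M \<and>
     (\<forall>i. enat i < n \<longrightarrow> cl (rule_of (r i)) (t i) (t (Suc i))) \<and>
     (\<forall>k. n = enat k \<longrightarrow> normal_form (cl sigma_beta_c) (t k))"

definition beta_steps :: "enat \<Rightarrow> (nat \<Rightarrow> rule_name) \<Rightarrow> enat" where
  "beta_steps n r =
     (let B = {i. enat i < n \<and> r i = Beta_c} in if finite B then enat (card B) else \<infinity>)"

end

(* Surface sigma is terminating and confluent, and it commutes with (weak or surface) beta_c: if
   M reduces by sigma to N1 and by beta_c to N2, then one beta_c step from N1 and some sigma steps
   from N2 meet; beta_c alone has the diamond property. So beta_c followed by sigma-normalization
   is a relation B on sigma-normal forms with the diamond property, and every maximal B-sequence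
   from a given term has the same length. Projecting a maximal sequence from M to sigma-normal forms
   gives a maximal B-sequence in which each beta_c step is one B step and sigma steps disappear.
   Uniform normalization follows, since an infinite sequence must contain infinitely many beta_c
   steps. *)

theory Submission imports Defs begin

section \<open>Random descent modulo a terminating confluent relation\<close>

text \<open>The commutation axiom returns exactly one \<open>b\<close> step on the far side of an
  \<open>s\<close> step, so that counting \<open>b\<close> steps is invariant under
  \<open>s\<close>. Two separate relations are taken because their closures under contexts may
  differ.\<close>

locale descent_modulo =
  fixes b s :: "'a \<Rightarrow> 'a \<Rightarrow> bool"
  assumes b_diamond: "b x y \<Longrightarrow> b x z \<Longrightarrow> y = z \<or> (\<exists>w. b y w \<and> b z w)"
    and s_b_commute: "s x y \<Longrightarrow> b x z \<Longrightarrow> \<exists>w. b y w \<and> s\<^sup>*\<^sup>* z w"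
    and s_locally_confluent: "s x y \<Longrightarrow> s x z \<Longrightarrow> \<exists>w. s\<^sup>*\<^sup>* y w \<and> s\<^sup>*\<^sup>* z w"
    and s_terminating: "wfP s\<inverse>\<inverse>"
begin

text \<open>Newman's lemma, by well-founded induction along \<open>s\<close>.\<close>

lemma s_confluent: "s\<^sup>*\<^sup>* x y \<Longrightarrow> s\<^sup>*\<^sup>* x z \<Longrightarrow> \<exists>w. s\<^sup>*\<^sup>* y w \<and> s\<^sup>*\<^sup>* z w"
proof (induction x arbitrary: y z rule: wfp_induct_rule[OF s_terminating])
  case (1 x)
  show ?case
  proof (cases "x = y \<or> x = z")
    case True
    then show ?thesis using 1(2,3) by blast
  next
    case False
    then obtain y' z' where y': "s x y'" "s\<^sup>*\<^sup>* y' y" and z': "s x z'" "s\<^sup>*\<^sup>* z' z"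
      using 1(2,3) by (metis converse_rtranclpE)
    obtain u where u: "s\<^sup>*\<^sup>* y' u" "s\<^sup>*\<^sup>* z' u"
      using s_locally_confluent[OF y'(1) z'(1)] by blast
    obtain v where v: "s\<^sup>*\<^sup>* y v" "s\<^sup>*\<^sup>* u v"
      using 1(1)[of y' y u] y' u by auto
    obtain w where "s\<^sup>*\<^sup>* v w" "s\<^sup>*\<^sup>* z w"
      using 1(1)[of z' v z] z' u v by (metis conversepI rtranclp_trans)
    then show ?thesis using v by (meson rtranclp_trans)
  qed
qed

definition nf :: "'a \<Rightarrow> 'a" where
  "nf x = (SOME y. s\<^sup>*\<^sup>* x y \<and> normal_form s y)"

lemma nf_exists: "\<exists>y. s\<^sup>*\<^sup>* x y \<and> normal_form s y"
proof (induction x rule: wfp_induct_rule[OF s_terminating])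
  case (1 x)
  then show ?case
    unfolding normal_form_def by (metis conversepI converse_rtranclp_into_rtranclp rtranclp.rtrancl_refl)
qed

lemma s_nf: "s\<^sup>*\<^sup>* x (nf x)" and normal_form_nf: "normal_form s (nf x)"
  using someI_ex[OF nf_exists[of x]] by (simp_all add: nf_def)

lemma normal_form_s_star: "normal_form s x \<Longrightarrow> s\<^sup>*\<^sup>* x y \<Longrightarrow> y = x"
  by (metis converse_rtranclpE normal_form_def)

text \<open>Both normal forms are reachable from \<open>x\<close>; confluence joins them, and two
  normal forms can only be joined by being equal. So the choice in \<open>nf\<close> is
  harmless.\<close>

lemma nf_eq: "s\<^sup>*\<^sup>* x y \<Longrightarrow> nf x = nf y"
  using s_confluent[of x "nf x" "nf y"]
  by (metis s_nf normal_form_nf normal_form_s_star rtranclp_trans)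

lemma s_star_b_commute: "s\<^sup>*\<^sup>* x y \<Longrightarrow> b x z \<Longrightarrow> \<exists>w. b y w \<and> s\<^sup>*\<^sup>* z w"
proof (induction rule: rtranclp_induct)
  case (step y y')
  then obtain w where w: "b y w" "s\<^sup>*\<^sup>* z w" by blast
  with s_b_commute[OF step(2) w(1)] show ?case by (meson rtranclp_trans)
qed blast

section \<open>Steps of \<open>b\<close> followed by \<open>s\<close>-normalization\<close>

definition B :: "'a \<Rightarrow> 'a \<Rightarrow> bool" where
  "B x y \<longleftrightarrow> (\<exists>z. b x z \<and> y = nf z)"

text \<open>Pushing the \<open>b\<close> step along the \<open>s\<close> steps from \<open>x\<close>
  to \<open>nf x\<close> leaves a single \<open>b\<close> step, whose target is an
  \<open>s\<close>-reduct of \<open>y\<close> and so has the normal form of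
  \<open>y\<close>.\<close>

lemma b_B_nf: "b x y \<Longrightarrow> B (nf x) (nf y)"
  unfolding B_def using s_star_b_commute[OF s_nf] nf_eq by metis

lemma B_diamond: "B x y \<Longrightarrow> B x z \<Longrightarrow> y = z \<or> (\<exists>w. B y w \<and> B z w)"
  unfolding B_def[of x] using b_diamond b_B_nf by metis

text \<open>Every step from \<open>x\<close> comes one closer to \<open>u\<close>: the diamond joins
  \<open>y\<close> with the first vertex \<open>v\<close> of the given path at some
  \<open>w\<close>, and induction along the rest of the path gives the distance from
  \<open>w\<close> to \<open>u\<close>.\<close>

lemma B_descent:
  assumes "(B ^^ Suc d) x u" "normal_form B u" "B x y"
  shows "(B ^^ d) y u"
  using assms(1,3)
proof (induction d arbitrary: x y)
  case 0
  then have "B x u" by auto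
  with 0(2) assms(2) B_diamond[of x u y] show ?case by (auto simp: normal_form_def)
next
  case (Suc d)
  obtain v where v: "B x v" "(B ^^ Suc d) v u"
    using Suc.prems(1) by (meson relpowp_Suc_E2)
  show ?case
  proof (cases "y = v")
    case False
    then obtain w where "B y w" "B v w" using B_diamond[OF v(1) Suc.prems(2)] by blast
    then show ?thesis using Suc.IH[OF v(2)] by (meson relpowp_Suc_I2)
  qed (use v in simp)
qed

text \<open>By \<open>B_descent\<close> each step lowers the distance to \<open>u\<close> by one,
  and at distance 0 no step is left.\<close>

lemma B_bounded:
  assumes "(B ^^ d) x u" "normal_form B u" "(B ^^ c) x y"
  shows "c \<le> d"
  using assms(1,3)
proof (induction c arbitrary: x d)
  case (Suc c)
  obtain v where v: "B x v" "(B ^^ c) v y"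
    using Suc.prems(2) by (meson relpowp_Suc_E2)
  obtain d' where d': "d = Suc d'"
    using Suc.prems(1) v(1) assms(2) by (cases d) (auto simp: normal_form_def)
  show ?case using Suc.IH[of d' v] B_descent[of d' x u v] Suc.prems(1) assms(2) v d' by simp
qed simp

text \<open>Under \<open>nf\<close> each \<open>b\<close> step becomes one \<open>B\<close> step and
  each \<open>s\<close> step an equality.\<close>

lemma B_relpow_labelled_seq:
  assumes "\<And>i. i < m \<Longrightarrow> (if p i then b else s) (t i) (t (Suc i))"
  shows "(B ^^ card {i. i < m \<and> p i}) (nf (t 0)) (nf (t m))"
  using assms
proof (induction m)
  case (Suc m)
  have IH: "(B ^^ card {i. i < m \<and> p i}) (nf (t 0)) (nf (t m))"
    using Suc.IH Suc.prems by simp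
  show ?case
  proof (cases "p m")
    case True
    then have "{i. i < Suc m \<and> p i} = insert m {i. i < m \<and> p i}" by auto
    moreover have "B (nf (t m)) (nf (t (Suc m)))"
      using Suc.prems[of m] True b_B_nf by simp
    ultimately show ?thesis using IH by auto
  next
    case False
    then have "{i. i < Suc m \<and> p i} = {i. i < m \<and> p i}" by (auto simp: less_Suc_eq)
    moreover have "nf (t m) = nf (t (Suc m))"
      using Suc.prems[of m] False by (auto intro: nf_eq)
    ultimately show ?thesis using IH by simp
  qed
qed simp

text \<open>Beyond the last label the sequence would be an infinite \<open>s\<close> chain.\<close>

lemma infinite_labels:
  assumes "\<And>i. (if p i then b else s) (t i) (t (Suc i))"
  shows "infinite {i. p i}"
proof
  assume "finite {i. p i}"
  then obtain k where k: "\<And>i. p i \<Longrightarrow> i < k"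
    using finite_nat_set_iff_bounded by auto
  have "s (t (k + i)) (t (k + Suc i))" for i
    using assms[of "k + i"] k[of "k + i"] by (cases "p (k + i)") auto
  then show False
    using s_terminating unfolding wfp_def wf_iff_no_infinite_down_chain
    by (auto dest!: spec[of _ "\<lambda>i. t (k + i)"])
qed

end

section \<open>Lifting and substitution\<close>

lemma lift_lift:
  "i \<le> k \<Longrightarrow> lift_val (lift_val V i) (Suc k) = lift_val (lift_val V k) i"
  "i \<le> k \<Longrightarrow> lift_comp (lift_comp M i) (Suc k) = lift_comp (lift_comp M k) i"
  by (induct V and M arbitrary: i k and i k) auto

lemma lift_subst:
  "j \<le> i \<Longrightarrow> lift_val (subst_val V U j) i = subst_val (lift_val V (Suc i)) (lift_val U i) j"
  "j \<le> i \<Longrightarrow> lift_comp (subst_comp M U j) i = subst_comp (lift_comp M (Suc i)) (lift_val U i) j"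
  by (induct V and M arbitrary: i j U and i j U) (auto simp: lift_lift)

lemma lift_subst_lt:
  "i \<le> j \<Longrightarrow> lift_val (subst_val V U j) i = subst_val (lift_val V i) (lift_val U i) (Suc j)"
  "i \<le> j \<Longrightarrow> lift_comp (subst_comp M U j) i = subst_comp (lift_comp M i) (lift_val U i) (Suc j)"
  by (induct V and M arbitrary: i j U and i j U) (auto simp: lift_lift)

text \<open>Index \<open>k\<close> is fresh after lifting at \<open>k\<close>. This is the form in
  which the proviso of \<open>sigma\<close> enters the diagrams.\<close>

lemma subst_lift [simp]:
  "subst_val (lift_val V k) U k = V"
  "subst_comp (lift_comp M k) U k = M"
  by (induct V and M arbitrary: k U and k U) auto

text \<open>The de Bruijn substitution lemma: moved below the binder of \<open>i\<close>, the
  substitution for \<open>j\<close> acts at \<open>Suc j\<close> with \<open>V\<close>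
  lifted.\<close>

lemma subst_subst:
  "i \<le> j \<Longrightarrow> subst_val (subst_val T (lift_val V i) (Suc j)) (subst_val U V j) i
     = subst_val (subst_val T U i) V j"
  "i \<le> j \<Longrightarrow> subst_comp (subst_comp M (lift_val V i) (Suc j)) (subst_val U V j) i
     = subst_comp (subst_comp M U i) V j"
  by (induct T and M arbitrary: i j U V and i j U V)
    (auto simp: lift_lift[symmetric] lift_subst_lt)

section \<open>Contextual closures\<close>

text \<open>The flag \<open>f\<close> permits steps below the abstraction of an application:
  \<open>False\<close> gives the weak closure and \<open>True\<close> the surface closure, so one
  induction serves both.\<close>

inductive ctx :: "bool \<Rightarrow> (comp \<Rightarrow> comp \<Rightarrow> bool) \<Rightarrow> comp \<Rightarrow> comp \<Rightarrow> bool" for f R where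
  top: "R P Q \<Longrightarrow> ctx f R P Q"
| right: "ctx f R P Q \<Longrightarrow> ctx f R (App V P) (App V Q)"
| left: "f \<Longrightarrow> ctx f R P Q \<Longrightarrow> ctx f R (App (Lam P) M) (App (Lam Q) M)"

lemma weak_fill_ctx: "R P Q \<Longrightarrow> ctx False R (weak_fill W P) (weak_fill W Q)"
  by (induct W) (auto intro: ctx.intros)

lemma surface_fill_ctx: "R P Q \<Longrightarrow> ctx True R (surface_fill S P) (surface_fill S Q)"
  by (induct S) (auto intro: ctx.intros)

lemma weak_eq_ctx: "weak R = ctx False R"
proof (intro ext iffI)
  fix M N
  show "weak R M N \<Longrightarrow> ctx False R M N"
    unfolding weak_def using weak_fill_ctx by blast
  show "ctx False R M N \<Longrightarrow> weak R M N"
  proof (induction rule: ctx.induct)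
    case (top P Q)
    then show ?case unfolding weak_def by (metis weak_fill.simps(1))
  next
    case (right P Q V)
    then show ?case unfolding weak_def by (metis weak_fill.simps(2))
  qed simp
qed

lemma surface_eq_ctx: "surface R = ctx True R"
proof (intro ext iffI)
  fix M N
  show "surface R M N \<Longrightarrow> ctx True R M N"
    unfolding surface_def using surface_fill_ctx by blast
  show "ctx True R M N \<Longrightarrow> surface R M N"
  proof (induction rule: ctx.induct)
    case (top P Q)
    then show ?case unfolding surface_def by (metis surface_fill.simps(1))
  next
    case (right P Q V)
    then show ?case unfolding surface_def by (metis surface_fill.simps(2))
  next
    case (left P Q M)
    then show ?case unfolding surface_def by (metis surface_fill.simps(3))
  qed
qed

lemma ctx_mono: "ctx f R M N \<Longrightarrow> (f \<Longrightarrow> g) \<Longrightarrow> ctx g R M N"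
  by (induction rule: ctx.induct) (auto intro: ctx.intros)

lemma ctx_sigma_beta_c: "ctx f sigma_beta_c M N \<longleftrightarrow> ctx f sigma M N \<or> ctx f beta_c M N"
proof
  show "ctx f sigma_beta_c M N \<Longrightarrow> ctx f sigma M N \<or> ctx f beta_c M N"
    by (induction rule: ctx.induct) (auto simp: sigma_beta_c_def intro: ctx.intros)
  have "ctx f R M N \<Longrightarrow> ctx f sigma_beta_c M N" if "R = sigma \<or> R = beta_c" for R
    by (induction rule: ctx.induct) (use that in \<open>auto simp: sigma_beta_c_def intro: ctx.intros\<close>)
  then show "ctx f sigma M N \<or> ctx f beta_c M N \<Longrightarrow> ctx f sigma_beta_c M N" by blast
qed

lemma ctx_right_star: "(ctx f R)\<^sup>*\<^sup>* M N \<Longrightarrow> (ctx f R)\<^sup>*\<^sup>* (App V M) (App V N)"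
  by (induction rule: rtranclp_induct) (auto intro: ctx.right rtranclp.rtrancl_into_rtrancl)

lemma ctx_left_star:
  "(ctx True R)\<^sup>*\<^sup>* M N \<Longrightarrow> (ctx True R)\<^sup>*\<^sup>* (App (Lam M) L) (App (Lam N) L)"
  by (induction rule: rtranclp_induct) (auto intro: ctx.left rtranclp.rtrancl_into_rtrancl)

inductive_cases beta_cE: "beta_c M N"
inductive_cases sigmaE: "sigma M N"
inductive_cases ctx_BangE: "ctx f R (Bang V) N"

lemma ctx_AppE:
  assumes "ctx f R (App V M) N"
  obtains "R (App V M) N" | Q where "N = App V Q" "ctx f R M Q"
  | P Q where "f" "V = Lam P" "N = App (Lam Q) M" "ctx f R P Q"
  using assms by (cases rule: ctx.cases) auto

lemma beta_c_AppE:
  assumes "beta_c (App V P) K"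
  obtains M U where "V = Lam M" "P = Bang U" "K = subst_comp M U 0"
  using assms by (auto elim: beta_c.cases)

lemma sigma_AppE:
  assumes "sigma (App V P) K"
  obtains N M L where "V = Lam N" "P = App (Lam M) L"
    "K = App (Lam (App (Lam (lift_comp N 1)) M)) L"
  using assms by (auto elim: sigma.cases)

lemma beta_cI: "N = subst_comp M V 0 \<Longrightarrow> beta_c (App (Lam M) (Bang V)) N"
  by (simp add: beta_c.intros)

lemma sigmaI:
  "K = App (Lam (App (Lam (lift_comp N 1)) M)) L \<Longrightarrow> sigma (App (Lam N) (App (Lam M) L)) K"
  using sigma.intros by simp

section \<open>Stability of both rules under lifting and substitution\<close>

lemma beta_c_lift: "beta_c M N \<Longrightarrow> beta_c (lift_comp M k) (lift_comp N k)"
  by (erule beta_cE) (auto intro!: beta_cI simp: lift_subst)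

lemma beta_c_subst: "beta_c M N \<Longrightarrow> beta_c (subst_comp M U k) (subst_comp N U k)"
  by (erule beta_cE) (auto intro!: beta_cI simp: subst_subst)

lemma sigma_lift: "sigma M N \<Longrightarrow> sigma (lift_comp M k) (lift_comp N k)"
  by (erule sigmaE) (auto intro!: sigmaI simp: lift_lift)

lemma sigma_subst: "sigma M N \<Longrightarrow> sigma (subst_comp M U k) (subst_comp N U k)"
  by (erule sigmaE) (auto intro!: sigmaI simp: lift_subst_lt lift_lift)

lemma ctx_lift:
  assumes "\<And>M N k. R M N \<Longrightarrow> R (lift_comp M k) (lift_comp N k)"
  shows "ctx f R M N \<Longrightarrow> ctx f R (lift_comp M k) (lift_comp N k)"
  by (induction arbitrary: k rule: ctx.induct) (auto intro: ctx.intros assms)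

lemma ctx_subst:
  assumes "\<And>M N U k. R M N \<Longrightarrow> R (subst_comp M U k) (subst_comp N U k)"
  shows "ctx f R M N \<Longrightarrow> ctx f R (subst_comp M U k) (subst_comp N U k)"
  by (induction arbitrary: U k rule: ctx.induct) (auto intro: ctx.intros assms)

lemma ctx_beta_c_lift:
  "ctx f beta_c M N \<Longrightarrow> ctx f beta_c (lift_comp M k) (lift_comp N k)"
  by (rule ctx_lift[of beta_c]) (rule beta_c_lift)

lemma ctx_beta_c_subst:
  "ctx f beta_c M N \<Longrightarrow> ctx f beta_c (subst_comp M U k) (subst_comp N U k)"
  by (rule ctx_subst[of beta_c]) (rule beta_c_subst)

lemma ctx_sigma_lift:
  "ctx f sigma M N \<Longrightarrow> ctx f sigma (lift_comp M k) (lift_comp N k)"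
  by (rule ctx_lift[of sigma]) (rule sigma_lift)

lemma ctx_sigma_subst:
  "ctx f sigma M N \<Longrightarrow> ctx f sigma (subst_comp M U k) (subst_comp N U k)"
  by (rule ctx_subst[of sigma]) (rule sigma_subst)

lemma not_ctx_Bang [simp]:
  "\<not> ctx f beta_c (Bang V) N" "\<not> ctx f sigma (Bang V) N"
  by (auto elim!: ctx_BangE elim: beta_cE sigmaE)

section \<open>Local diagrams\<close>

text \<open>The argument \<open>Bang V\<close> of a redex admits no step, so contraction neither
  copies nor erases another redex, and a step in the body survives substitution as one step.\<close>

lemma ctx_beta_c_diamond:
  "ctx f beta_c M N1 \<Longrightarrow> ctx f beta_c M N2 \<Longrightarrow>
    N1 = N2 \<or> (\<exists>Q. ctx f beta_c N1 Q \<and> ctx f beta_c N2 Q)"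
proof (induction arbitrary: N2 rule: ctx.induct)
  case (top P Q)
  from top(1) show ?case
  proof (rule beta_cE)
    fix M V assume eq: "P = App (Lam M) (Bang V)" "Q = subst_comp M V 0"
    from top(2)[unfolded eq] show ?thesis
    proof (rule ctx_AppE)
      fix P Q assume "f" "Lam M = Lam P" "N2 = App (Lam Q) (Bang V)" "ctx f beta_c P Q"
      then show ?thesis
        unfolding eq using ctx_beta_c_subst ctx.top[of beta_c, OF beta_c.intros] by blast
    qed (use eq in \<open>auto elim: beta_c_AppE\<close>)
  qed
next
  case (right P Q V)
  from right.prems show ?case
  proof (rule ctx_AppE)
    assume "beta_c (App V P) N2"
    then show ?thesis using right.hyps by (auto elim!: beta_cE)
  next
    fix P' Q' assume "f" "V = Lam P'" "N2 = App (Lam Q') P" "ctx f beta_c P' Q'"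
    then show ?thesis using right.hyps by (blast intro: ctx.intros)
  next
    fix Q' assume "N2 = App V Q'" "ctx f beta_c P Q'"
    then show ?thesis using right.IH by (blast intro: ctx.intros)
  qed
next
  case (left P Q M)
  from left.prems show ?case
  proof (rule ctx_AppE)
    assume "beta_c (App (Lam P) M) N2"
    then show ?thesis
    proof (cases rule: beta_c_AppE)
      case (1 P' V)
      with left.hyps show ?thesis
        using ctx_beta_c_subst ctx.top[of beta_c, OF beta_c.intros] by blast
    qed
  next
    fix P' Q' assume "f" "Lam P = Lam P'" "N2 = App (Lam Q') M" "ctx f beta_c P' Q'"
    then show ?thesis using left.IH left.hyps by (blast intro: ctx.intros)
  next
    fix Q' assume "N2 = App (Lam P) Q'" "ctx f beta_c M Q'"
    then show ?thesis using left.hyps by (blast intro: ctx.intros)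
  qed
qed


text \<open>The \<open>beta_c\<close> step stays in the closure given by \<open>f\<close>:
  \<open>sigma\<close> keeps \<open>L\<close> in weak position, while \<open>N\<close> and
  \<open>M\<close> sit below abstractions where a step requires \<open>f\<close>, or are consumed by
  the overlap in which \<open>App (Lam M) L\<close> is the redex.\<close>

lemma ctx_sigma_beta_c_commute:
  "ctx f beta_c M N2 \<Longrightarrow> ctx True sigma M N1 \<Longrightarrow>
    \<exists>Q. ctx f beta_c N1 Q \<and> (ctx True sigma)\<^sup>*\<^sup>* N2 Q"
proof (induction arbitrary: N1 rule: ctx.induct)
  case (top P Q)
  from top(1) show ?case
  proof (rule beta_cE)
    fix M V assume eq: "P = App (Lam M) (Bang V)" "Q = subst_comp M V 0"
    from top(2)[unfolded eq] show ?thesis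
    proof (rule ctx_AppE)
      fix P Q assume "True" "Lam M = Lam P" "N1 = App (Lam Q) (Bang V)" "ctx True sigma P Q"
      then show ?thesis
        unfolding eq using ctx_sigma_subst ctx.top[of beta_c, OF beta_c.intros] by blast
    qed (auto elim: sigmaE)
  qed
next
  case (right P Q V)
  from right.prems show ?case
  proof (rule ctx_AppE)
    assume "sigma (App V P) N1"
    then show ?thesis
    proof (cases rule: sigma_AppE)
      case (1 N M L)
      note eqs = this
      from right.hyps(1)[unfolded eqs] show ?thesis
      proof (rule ctx_AppE)
        assume "beta_c (App (Lam M) L) Q"
        then obtain U where U: "L = Bang U" "Q = subst_comp M U 0" by (auto elim: beta_cE)
        \<comment> \<open>Substituting at index 1 cancels the lift of \<open>N\<close>, so
          contraction after \<open>sigma\<close> lands on \<open>App (Lam N) Q\<close> itself and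
          zero \<open>sigma\<close> steps close the diagram.\<close>
        have "beta_c (App (Lam (App (Lam (lift_comp N 1)) M)) L) (App (Lam N) Q)"
          unfolding U by (rule beta_cI) simp
        then show ?thesis unfolding eqs by (blast intro: ctx.top)
      next
        fix P' Q' assume "f" "Lam M = Lam P'" "Q = App (Lam Q') L" "ctx f beta_c P' Q'"
        then show ?thesis unfolding eqs by (blast intro: ctx.intros sigma.intros)
      next
        fix Q' assume "Q = App (Lam M) Q'" "ctx f beta_c L Q'"
        then show ?thesis unfolding eqs by (blast intro: ctx.intros sigma.intros)
      qed
    qed
  next
    fix P' Q' assume "True" "V = Lam P'" "N1 = App (Lam Q') P" "ctx True sigma P' Q'"
    then show ?thesis using right.hyps by (blast intro: ctx.intros)
  next
    fix Q' assume "N1 = App V Q'" "ctx True sigma P Q'"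
    then show ?thesis using right.IH by (blast intro: ctx.intros ctx_right_star)
  qed
next
  case (left P Q M)
  from left.prems show ?case
  proof (rule ctx_AppE)
    assume "sigma (App (Lam P) M) N1"
    then show ?thesis
    proof (cases rule: sigma_AppE)
      case (1 N M' L)
      have "ctx f beta_c (lift_comp P 1) (lift_comp Q 1)"
        using ctx_beta_c_lift left.hyps 1 by blast
      with left.hyps 1 show ?thesis by (blast intro: ctx.intros sigma.intros)
    qed
  next
    fix P' Q' assume "True" "Lam P = Lam P'" "N1 = App (Lam Q') M" "ctx True sigma P' Q'"
    then show ?thesis using left.IH left.hyps by (blast intro: ctx.intros ctx_left_star)
  next
    fix Q' assume "N1 = App (Lam P) Q'" "ctx True sigma M Q'"
    then show ?thesis using left.hyps by (blast intro: ctx.intros)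
  qed
qed

section \<open>Local confluence of surface \<open>sigma\<close>\<close>

text \<open>The critical pair arises when the argument is itself a \<open>sigma\<close> redex: one
  further step from one side meets two from the other. The remaining steps lie inside
  \<open>M\<close> or \<open>L\<close> and are merely moved along.\<close>

lemma sigma_right_joinable:
  assumes "sigma (App V P) N1" "ctx True sigma P Q"
  shows "\<exists>K. (ctx True sigma)\<^sup>*\<^sup>* N1 K \<and> (ctx True sigma)\<^sup>*\<^sup>* (App V Q) K"
  using assms(1)
proof (cases rule: sigma_AppE)
  case (1 N M L)
  note eqs = this
  from assms(2)[unfolded eqs] show ?thesis
  proof (rule ctx_AppE)
    assume "sigma (App (Lam M) L) Q"
    then show ?thesis
    proof (cases rule: sigma_AppE)
      case (1 M0 M1 L1)
      let ?A = "App (Lam (App (Lam (lift_comp N 1)) M)) (App (Lam M1) L1)"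
      let ?B = "App (Lam N) (App (Lam (App (Lam (lift_comp M 1)) M1)) L1)"
      let ?C = "App (Lam (App (Lam (lift_comp N 1)) (App (Lam (lift_comp M 1)) M1))) L1"
      let ?D = "App (Lam (App (Lam (App (Lam (lift_comp (lift_comp N 1) 1)) (lift_comp M 1))) M1)) L1"
      \<comment> \<open>Lifting \<open>App (Lam (lift_comp N 1)) M\<close> at 1 uses cutoff 2 below
        the inner binder; \<open>lift_lift\<close> turns this into the double lift at 1 that the
        other route yields.\<close>
      have "ctx True sigma ?A ?D"
        using lift_lift(2)[of 1 1 N] by (intro ctx.top sigmaI) simp
      moreover have "ctx True sigma ?B ?C" by (intro ctx.top sigmaI) simp
      \<comment> \<open>This step fires below an abstraction, which only the surface closure
        allows.\<close>
      moreover have "ctx True sigma ?C ?D" by (intro ctx.left ctx.top sigmaI) simp_all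
      ultimately show ?thesis unfolding eqs using 1
        by (auto intro!: exI[of _ ?D] intro: converse_rtranclp_into_rtranclp)
    qed
  next
    fix P' Q' assume "True" "Lam M = Lam P'" "Q = App (Lam Q') L" "ctx True sigma P' Q'"
    then show ?thesis unfolding eqs
      by (blast intro: ctx.intros sigma.intros)
  next
    fix Q' assume "Q = App (Lam M) Q'" "ctx True sigma L Q'"
    then show ?thesis unfolding eqs
      by (blast intro: ctx.intros sigma.intros)
  qed
qed

lemma sigma_left_joinable:
  assumes "sigma (App (Lam P) M) N1" "ctx True sigma P Q"
  shows "\<exists>K. (ctx True sigma)\<^sup>*\<^sup>* N1 K \<and> (ctx True sigma)\<^sup>*\<^sup>* (App (Lam Q) M) K"
  using assms(1)
proof (cases rule: sigma_AppE)
  case (1 N M' L)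
  have "ctx True sigma (lift_comp P 1) (lift_comp Q 1)"
    using ctx_sigma_lift assms(2) 1 by blast
  with 1 show ?thesis by (blast intro: ctx.intros sigma.intros)
qed

lemma surface_sigma_locally_confluent:
  "ctx True sigma M N1 \<Longrightarrow> ctx True sigma M N2 \<Longrightarrow>
    \<exists>K. (ctx True sigma)\<^sup>*\<^sup>* N1 K \<and> (ctx True sigma)\<^sup>*\<^sup>* N2 K"
proof (induction arbitrary: N2 rule: ctx.induct)
  case (top P Q)
  from top(1) obtain V M where P: "P = App V M" by (auto elim: sigmaE)
  from top(2)[unfolded P] show ?case
  proof (rule ctx_AppE)
    assume "sigma (App V M) N2"
    then show ?thesis using top(1) P by (auto elim!: sigmaE)
  next
    fix P' Q' assume "True" "V = Lam P'" "N2 = App (Lam Q') M" "ctx True sigma P' Q'"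
    then show ?thesis using sigma_left_joinable top(1) P by blast
  next
    fix Q' assume "N2 = App V Q'" "ctx True sigma M Q'"
    then show ?thesis using sigma_right_joinable top(1) P by blast
  qed
next
  case (right P Q V)
  from right.prems show ?case
  proof (rule ctx_AppE)
    assume "sigma (App V P) N2"
    then show ?thesis using sigma_right_joinable right.hyps by blast
  next
    fix P' Q' assume "True" "V = Lam P'" "N2 = App (Lam Q') P" "ctx True sigma P' Q'"
    then show ?thesis using right.hyps by (blast intro: ctx.intros)
  next
    fix Q' assume "N2 = App V Q'" "ctx True sigma P Q'"
    then show ?thesis using right.IH by (blast intro: ctx_right_star)
  qed
next
  case (left P Q M)
  from left.prems show ?case
  proof (rule ctx_AppE)
    assume "sigma (App (Lam P) M) N2"
    then show ?thesis using sigma_left_joinable left.hyps by blast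
  next
    fix P' Q' assume "True" "Lam P = Lam P'" "N2 = App (Lam Q') M" "ctx True sigma P' Q'"
    then show ?thesis using left.IH by (blast intro: ctx_left_star)
  next
    fix Q' assume "N2 = App (Lam P) Q'" "ctx True sigma M Q'"
    then show ?thesis using left.hyps by (blast intro: ctx.intros)
  qed
qed

section \<open>Termination of surface \<open>sigma\<close>\<close>

text \<open>Arguments weigh twice: with \<open>L\<close> in the argument of an argument on the left of \<open>sigma\<close> but
  only in an argument on the right, the weight drops by twice that of \<open>L\<close>.\<close>

primrec weight_val :: "val \<Rightarrow> nat" and weight :: "comp \<Rightarrow> nat" where
  "weight_val (Var i) = 0"
| "weight_val (Lam M) = weight M"
| "weight (Bang V) = 1"
| "weight (App V M) = weight_val V + 2 * weight M"

lemma weight_lift [simp]: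
  "weight_val (lift_val V k) = weight_val V"
  "weight (lift_comp M k) = weight M"
  by (induct V and M arbitrary: k and k) auto

text \<open>Makes the drop by twice the weight of \<open>L\<close> strict.\<close>

lemma weight_pos: "weight M > 0"
  by (induct M rule: comp.induct[of "\<lambda>_. True"]) auto

lemma surface_sigma_weight: "ctx True sigma M N \<Longrightarrow> weight N < weight M"
  by (induction rule: ctx.induct) (auto elim!: sigmaE simp: weight_pos)

lemma surface_sigma_terminating: "wfP (ctx True sigma)\<inverse>\<inverse>"
  by (rule wfp_if_convertible_to_nat[of _ weight]) (auto dest: surface_sigma_weight)

text \<open>Weak \<open>sigma\<close> alone is not confluent, so the weak \<open>beta_c\<close> is taken modulo
  surface \<open>sigma\<close> as well.\<close>

interpretation ctx: descent_modulo "ctx f beta_c" "ctx True sigma" for f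
  by unfold_locales
    (use ctx_beta_c_diamond ctx_sigma_beta_c_commute surface_sigma_locally_confluent
      surface_sigma_terminating in blast)+

section \<open>Counting \<open>beta_c\<close> steps\<close>

lemma not_ctx_sigma_to_Bang: "\<not> ctx f sigma M (Bang V)"
  by (auto elim: ctx.cases sigma.cases)

text \<open>No weak redex is created: \<open>sigma\<close> never yields a \<open>Bang\<close>, and
  if its contractum is itself a redex then \<open>L\<close> is a \<open>Bang\<close>, so
  \<open>App (Lam M) L\<close> was already a redex in weak position.\<close>

lemma surface_sigma_reflects_weak_beta_c:
  "ctx True sigma M N \<Longrightarrow> ctx False beta_c N K \<Longrightarrow> \<exists>K'. ctx False beta_c M K'"
proof (induction arbitrary: K rule: ctx.induct)
  case (top P Q)
  from top(1) obtain N M L where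
    eqs: "P = App (Lam N) (App (Lam M) L)" "Q = App (Lam (App (Lam (lift_comp N 1)) M)) L"
    by (auto elim: sigma.cases)
  from top(2)[unfolded eqs] show ?case unfolding eqs
    by (rule ctx_AppE) (blast intro: ctx.intros beta_c.intros elim: beta_c_AppE)+
next
  case (right P Q V)
  from right.prems show ?case
    by (rule ctx_AppE)
      (use right not_ctx_sigma_to_Bang in \<open>blast intro: ctx.intros elim: beta_c_AppE\<close>)+
next
  case (left P Q M)
  from left.prems show ?case
    by (rule ctx_AppE) (blast intro: ctx.intros beta_c.intros elim: beta_c_AppE)+
qed

text \<open>For the surface closure \<open>M\<close> is already \<open>sigma\<close>-normal, so
  \<open>N = M\<close>. A weak normal form may still admit surface \<open>sigma\<close> steps, but
  these create no weak \<open>beta_c\<close> redex.\<close>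

lemma surface_sigma_star_normal_form:
  assumes "normal_form (ctx f sigma_beta_c) M" "(ctx True sigma)\<^sup>*\<^sup>* M N"
  shows "normal_form (ctx f beta_c) N"
proof (cases f)
  case True
  then show ?thesis
    using assms ctx.normal_form_s_star[of M N] by (auto simp: normal_form_def ctx_sigma_beta_c)
next
  case False
  have "normal_form (ctx f beta_c) M"
    using assms(1) by (auto simp: normal_form_def ctx_sigma_beta_c)
  with assms(2) show ?thesis
  proof (induction rule: rtranclp_induct)
    case (step y z)
    then show ?case
      using False surface_sigma_reflects_weak_beta_c[of y z] by (auto simp: normal_form_def)
  qed
qed

text \<open>Reads weak \<open>sigma\<close> steps as surface ones, the form that the projection to
  normal forms expects.\<close>

lemma maximal_seq_step:
  assumes "maximal_seq (ctx f) M n t r" "enat i < n"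
  shows "(if r i = Beta_c then ctx f beta_c else ctx True sigma) (t i) (t (Suc i))"
proof -
  have "ctx f (rule_of (r i)) (t i) (t (Suc i))"
    using assms by (auto simp: maximal_seq_def)
  then show ?thesis by (cases "r i") (auto intro: ctx_mono)
qed

text \<open>A discrete intermediate value argument: the count grows by at most one per
  position.\<close>

lemma ex_card_prefix:
  fixes p :: "nat \<Rightarrow> bool"
  assumes "c \<le> card {i. i < k \<and> p i}"
  shows "\<exists>m\<le>k. card {i. i < m \<and> p i} = c"
  using assms
proof (induction k)
  case (Suc k)
  show ?case
  proof (cases "c \<le> card {i. i < k \<and> p i}")
    case True
    then show ?thesis using Suc.IH by (meson le_SucI)
  next
    case False
    have "{i. i < Suc k \<and> p i} \<subseteq> insert k {i. i < k \<and> p i}" by auto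
    then have "card {i. i < Suc k \<and> p i} \<le> card (insert k {i. i < k \<and> p i})"
      by (intro card_mono) auto
    also have "\<dots> \<le> Suc (card {i. i < k \<and> p i})" by (simp add: card_insert_if)
    finally have "card {i. i < Suc k \<and> p i} \<le> Suc (card {i. i < k \<and> p i})" .
    with False Suc.prems show ?thesis by (intro exI[of _ "Suc k"]) auto
  qed
qed auto

text \<open>The right-hand side mentions only \<open>M\<close>, so the count cannot depend on the
  sequence. Prefixes of the sequence project to \<open>B\<close> paths; for a finite sequence the
  endpoint is \<open>B\<close>-normal and \<open>B_bounded\<close> gives the converse.\<close>

lemma le_beta_steps_iff:
  assumes seq: "maximal_seq (ctx f) M n t r"
  shows "enat c \<le> beta_steps n r \<longleftrightarrow> (\<exists>X. (ctx.B f ^^ c) (ctx.nf M) X)"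
proof -
  have t0: "t 0 = M" using seq by (simp add: maximal_seq_def)
  have prefix: "(ctx.B f ^^ card {i. i < m \<and> r i = Beta_c}) (ctx.nf M) (ctx.nf (t m))"
    if "enat m \<le> n" for m
    unfolding t0[symmetric]
  proof (rule ctx.B_relpow_labelled_seq)
    fix i assume "i < m"
    then have "enat i < n" using that by (meson enat_ord_simps(2) less_le_trans)
    then show "(if r i = Beta_c then ctx f beta_c else ctx True sigma) (t i) (t (Suc i))"
      using maximal_seq_step[OF seq] by blast
  qed
  show ?thesis
  proof (cases n)
    case (enat k)
    let ?d = "card {i. i < k \<and> r i = Beta_c}"
    have steps: "beta_steps n r = enat ?d" by (simp add: beta_steps_def enat)
    have "normal_form (ctx f sigma_beta_c) (t k)"
      using seq enat by (simp add: maximal_seq_def)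
    then have "normal_form (ctx f beta_c) (ctx.nf (t k))"
      using surface_sigma_star_normal_form ctx.s_nf by blast
    then have normal: "normal_form (ctx.B f) (ctx.nf (t k))"
      by (auto simp: normal_form_def ctx.B_def)
    show ?thesis
    proof
      assume "enat c \<le> beta_steps n r"
      then obtain m where "m \<le> k" "card {i. i < m \<and> r i = Beta_c} = c"
        using ex_card_prefix[of c k "\<lambda>i. r i = Beta_c"] steps by auto
      then show "\<exists>X. (ctx.B f ^^ c) (ctx.nf M) X" using prefix[of m] enat by auto
    next
      assume "\<exists>X. (ctx.B f ^^ c) (ctx.nf M) X"
      then show "enat c \<le> beta_steps n r"
        using ctx.B_bounded[OF prefix[of k] normal] enat steps by auto
    qed
  next
    case infinity
    \<comment> \<open>Here the count is infinite, so the left side always holds and a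
      \<open>B\<close> path of each length \<open>c\<close> has to be found.\<close>
    have inf: "infinite {i. r i = Beta_c}"
      using ctx.infinite_labels[where f = f and t = t and p = "\<lambda>i. r i = Beta_c"]
        maximal_seq_step[OF seq] infinity by auto
    obtain A where A: "A \<subseteq> {i. r i = Beta_c}" "finite A" "card A = c"
      using infinite_arbitrarily_large[OF inf] by blast
    obtain k where "A \<subseteq> {..<k}" using A(2) finite_nat_iff_bounded by auto
    then have "c \<le> card {i. i < k \<and> r i = Beta_c}"
      using A by (auto intro!: card_mono)
    then obtain m where "card {i. i < m \<and> r i = Beta_c} = c"
      using ex_card_prefix[of c k "\<lambda>i. r i = Beta_c"] by blast
    then show ?thesis
      using prefix[of m] infinity inf by (auto simp: beta_steps_def)
  qed
qed

lemma beta_steps_eq: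
  assumes "maximal_seq (ctx f) M n t r" "maximal_seq (ctx f) M n' t' r'"
  shows "beta_steps n r = beta_steps n' r'"
proof -
  have le: "enat c \<le> beta_steps n r \<longleftrightarrow> enat c \<le> beta_steps n' r'" for c
    using le_beta_steps_iff[OF assms(1)] le_beta_steps_iff[OF assms(2)] by simp
  show ?thesis
    \<comment> \<open>If both counts are finite, their values as bounds give antisymmetry; if just
      one is infinite, the successor of the other separates them.\<close>
    using le[of "the_enat (beta_steps n r)"] le[of "Suc (the_enat (beta_steps n r))"]
      le[of "the_enat (beta_steps n' r')"] le[of "Suc (the_enat (beta_steps n' r'))"]
    by (cases "beta_steps n r"; cases "beta_steps n' r'") (auto intro: antisym)
qed

section \<open>Uniform normalization\<close>

lemma ctx_sigma_beta_c_rule_of: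
  "ctx f sigma_beta_c M N \<longleftrightarrow> (\<exists>q. ctx f (rule_of q) M N)"
proof
  assume "ctx f sigma_beta_c M N"
  then show "\<exists>q. ctx f (rule_of q) M N"
    unfolding ctx_sigma_beta_c by (metis rule_of.simps)
next
  assume "\<exists>q. ctx f (rule_of q) M N"
  then obtain q where "ctx f (rule_of q) M N" ..
  then show "ctx f sigma_beta_c M N" by (cases q) (auto simp: ctx_sigma_beta_c)
qed

text \<open>With rule names chosen for their steps, a normalizing sequence and an infinite one from
  \<open>M\<close> are both maximal; the first has finitely many \<open>beta_c\<close> steps and the
  second infinitely many, against \<open>beta_steps_eq\<close>.\<close>

lemma ctx_uniformly_normalizing: "uniformly_normalizing (ctx f sigma_beta_c)"
  unfolding uniformly_normalizing_def strongly_normalizing_def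
proof (intro allI impI notI)
  fix M assume "weakly_normalizing (ctx f sigma_beta_c) M"
  then obtain N k where "(ctx f sigma_beta_c ^^ k) M N" and N: "normal_form (ctx f sigma_beta_c) N"
    unfolding weakly_normalizing_def by (auto dest: rtranclp_imp_relpowp)
  then obtain t where t: "t 0 = M" "t k = N" "\<forall>i<k. ctx f sigma_beta_c (t i) (t (Suc i))"
    unfolding relpowp_fun_conv by blast
  obtain r where "\<forall>i<k. ctx f (rule_of (r i)) (t i) (t (Suc i))"
    using t(3) unfolding ctx_sigma_beta_c_rule_of by metis
  then have fin: "maximal_seq (ctx f) M (enat k) t r"
    using t N by (simp add: maximal_seq_def)
  assume "\<exists>g. g 0 = M \<and> (\<forall>i. ctx f sigma_beta_c (g i) (g (Suc i)))"
  then obtain g where g: "g 0 = M" "\<forall>i. ctx f sigma_beta_c (g i) (g (Suc i))" by blast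
  obtain q where "\<forall>i. ctx f (rule_of (q i)) (g i) (g (Suc i))"
    using g(2) unfolding ctx_sigma_beta_c_rule_of by metis
  then have inf: "maximal_seq (ctx f) M \<infinity> g q"
    using g(1) by (simp add: maximal_seq_def)
  have "infinite {i. q i = Beta_c}"
    using ctx.infinite_labels[where f = f and t = g and p = "\<lambda>i. q i = Beta_c"]
      maximal_seq_step[OF inf] by auto
  then show False
    using beta_steps_eq[OF fin inf] by (simp add: beta_steps_def)
qed

theorem mainTheorem7:
  "uniformly_normalizing (weak sigma_beta_c) \<and>
   uniformly_normalizing (surface sigma_beta_c) \<and>
   (\<forall>M n t r n' t' r'. maximal_seq weak M n t r \<and> maximal_seq weak M n' t' r' \<longrightarrow>
      beta_steps n r = beta_steps n' r') \<and>
   (\<forall>M n t r n' t' r'. maximal_seq surface M n t r \<and> maximal_seq surface M n' t' r' \<longrightarrow>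
      beta_steps n r = beta_steps n' r')"
proof -
  have eqs: "weak = ctx False" "surface = ctx True"
    by (simp_all add: fun_eq_iff weak_eq_ctx surface_eq_ctx)
  show ?thesis
    unfolding eqs
    by (intro conjI allI impI ctx_uniformly_normalizing) (erule conjE, erule beta_steps_eq, assumption)+
qed

end
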